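(* As $g\to\infty$ one has $$\mu_g \ = \ g^{-1/2}+O(g^{-1}).$$
   Context: For $g\ge 2$ let $\Gamma_g$ be the fundamental group of the closed orientable surface of genus $g$, given by the presentation $\Gamma_g=\langle a_1,b_1,\dots,a_g,b_g \mid \prod_{j=1}^g a_jb_ja_j^{-1}b_j^{-1}=1\rangle$, and let $S_g=\{a_1,a_1^{-1},b_1,b_1^{-1},\dots,a_g,a_g^{-1},b_g,b_g^{-1}\}$, a symmetric generating set with $4g$ elements. The Cayley graph $X_g=\mathrm{Cay}(\Gamma_g,S_g)$ has vertex set $\Gamma_g$, with $\{x,y\}$ an edge if and only if $x^{-1}y\in S_g$; it is $4g$-regular. The Markov operator $M$ of a connected $k$-regular graph with vertex set $X^0$ is $(Mf)(x)=\frac1k\sum_{y\sim x}f(y)$ (sum over neighbours $y$ of $x$), a bounded self-adjoint operator on $\ell^2(X^0)$; the spectral radius of the graph is the operator norm of $M$ on $\ell^2(X^0)$. The number $\mu_g$ is the spectral radius of $X_g$. *)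

theory Defs
  imports "HOL-Algebra.Group" "HOL-Analysis.Analysis" "HOL-Library.Landau_Symbols"
begin

section \<open>Groups given by a presentation\<close>

text \<open>A letter \<open>(x, True)\<close> stands for the generator \<open>x\<close> and \<open>(x, False)\<close> for its formal inverse.\<close>

type_synonym 'x letter = "'x \<times> bool"

inductive pres_eq :: "'x set \<Rightarrow> 'x letter list set \<Rightarrow> 'x letter list \<Rightarrow> 'x letter list \<Rightarrow> bool"
  for X R where
  pres_refl: "u \<in> lists (X \<times> UNIV) \<Longrightarrow> pres_eq X R u u"
| pres_sym: "pres_eq X R u v \<Longrightarrow> pres_eq X R v u"
| pres_trans: "pres_eq X R u v \<Longrightarrow> pres_eq X R v w \<Longrightarrow> pres_eq X R u w"
| pres_cancel: "u \<in> lists (X \<times> UNIV) \<Longrightarrow> v \<in> lists (X \<times> UNIV) \<Longrightarrow> x \<in> X \<Longrightarrow>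
    pres_eq X R (u @ [(x, e), (x, \<not> e)] @ v) (u @ v)"
| pres_relator: "u \<in> lists (X \<times> UNIV) \<Longrightarrow> v \<in> lists (X \<times> UNIV) \<Longrightarrow>
    r \<in> R \<Longrightarrow> r \<in> lists (X \<times> UNIV) \<Longrightarrow> pres_eq X R (u @ r @ v) (u @ v)"

definition pres_rel :: "'x set \<Rightarrow> 'x letter list set \<Rightarrow> ('x letter list \<times> 'x letter list) set" where
  "pres_rel X R = {(u, v). pres_eq X R u v}"

definition pres_class :: "'x set \<Rightarrow> 'x letter list set \<Rightarrow> 'x letter list \<Rightarrow> 'x letter list set" where
  "pres_class X R u = pres_rel X R `` {u}"

definition presented_group :: "'x set \<Rightarrow> 'x letter list set \<Rightarrow> 'x letter list set monoid" where
  "presented_group X R =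
    \<lparr> carrier = lists (X \<times> UNIV) // pres_rel X R,
      monoid.mult = (\<lambda>A B. \<Union>u\<in>A. \<Union>v\<in>B. pres_class X R (u @ v)),
      one = pres_class X R [] \<rparr>"

lemma pres_eq_words:
  assumes "pres_eq X R u v"
  shows "u \<in> lists (X \<times> UNIV) \<and> v \<in> lists (X \<times> UNIV)"
  using assms by induction auto

lemma equiv_pres_rel: "equiv (lists (X \<times> UNIV)) (pres_rel X R)"
proof (rule equivI)
  show "pres_rel X R \<subseteq> lists (X \<times> UNIV) \<times> lists (X \<times> UNIV)"
    using pres_eq_words unfolding pres_rel_def by blast
  show "refl_on (lists (X \<times> UNIV)) (pres_rel X R)"
    unfolding refl_on_def pres_rel_def by (auto intro: pres_refl)
  show "sym (pres_rel X R)"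
    by (rule symI) (simp add: pres_rel_def pres_sym)
  show "trans (pres_rel X R)"
    by (rule transI) (simp add: pres_rel_def, rule pres_trans)
qed

lemma pres_eq_append_right:
  assumes "pres_eq X R u v" and w: "w \<in> lists (X \<times> UNIV)"
  shows "pres_eq X R (u @ w) (v @ w)"
  using assms(1)
proof induction
  case (pres_refl u)
  then show ?case using w by (intro pres_eq.pres_refl) auto
next
  case (pres_cancel u v x e)
  then show ?case using w pres_eq.pres_cancel[of u X "v @ w" x R e] by simp
next
  case (pres_relator u v r)
  then show ?case using w pres_eq.pres_relator[of u X "v @ w" r R] by simp
next
  case (pres_sym u v)
  then show ?case by (simp only: pres_eq.pres_sym)
next
  case (pres_trans u v w')
  from pres_trans.IH show ?case by (rule pres_eq.pres_trans)
qed

lemma pres_eq_append_left: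
  assumes "pres_eq X R u v" and w: "w \<in> lists (X \<times> UNIV)"
  shows "pres_eq X R (w @ u) (w @ v)"
  using assms(1)
proof induction
  case (pres_refl u)
  then show ?case using w by (intro pres_eq.pres_refl) auto
next
  case (pres_cancel u v x e)
  then show ?case using w pres_eq.pres_cancel[of "w @ u" X v x R e] by simp
next
  case (pres_relator u v r)
  then show ?case using w pres_eq.pres_relator[of "w @ u" X v r R] by simp
next
  case (pres_sym u v)
  then show ?case by (simp only: pres_eq.pres_sym)
next
  case (pres_trans u v w')
  from pres_trans.IH show ?case by (rule pres_eq.pres_trans)
qed

lemma pres_eq_append:
  assumes "pres_eq X R u u'" and "pres_eq X R v v'"
  shows "pres_eq X R (u @ v) (u' @ v')"
proof (rule pres_trans)
  show "pres_eq X R (u @ v) (u' @ v)"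
    using assms(1) pres_eq_words[OF assms(2)] by (intro pres_eq_append_right) auto
  show "pres_eq X R (u' @ v) (u' @ v')"
    using assms(2) pres_eq_words[OF assms(1)] by (intro pres_eq_append_left) auto
qed

lemma pres_class_eq_iff:
  assumes "u \<in> lists (X \<times> UNIV)" "v \<in> lists (X \<times> UNIV)"
  shows "pres_class X R u = pres_class X R v \<longleftrightarrow> pres_eq X R u v"
  using eq_equiv_class_iff[OF equiv_pres_rel assms] unfolding pres_class_def
  by (simp add: pres_rel_def)

lemma presented_group_mult:
  assumes "u \<in> lists (X \<times> UNIV)" "v \<in> lists (X \<times> UNIV)"
  shows "pres_class X R u \<otimes>\<^bsub>presented_group X R\<^esub> pres_class X R v = pres_class X R (u @ v)"
proof -
  have *: "pres_class X R (u' @ v') = pres_class X R (u @ v)"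
    if "u' \<in> pres_class X R u" "v' \<in> pres_class X R v" for u' v'
  proof -
    have "pres_eq X R (u @ v) (u' @ v')"
      using that by (intro pres_eq_append) (auto simp: pres_class_def pres_rel_def)
    then show ?thesis
      using pres_class_eq_iff[of "u @ v" X "u' @ v'" R] pres_eq_words[of X R "u @ v" "u' @ v'"]
      by simp
  qed
  have "u \<in> pres_class X R u" "v \<in> pres_class X R v"
    using assms by (auto simp: pres_class_def pres_rel_def intro: pres_refl)
  then have "(\<Union>u'\<in>pres_class X R u. \<Union>v'\<in>pres_class X R v. pres_class X R (u' @ v')) =
      pres_class X R (u @ v)"
    using * by blast
  then show ?thesis
    by (simp add: presented_group_def)
qed

lemma pres_eq_inverse:
  assumes "u \<in> lists (X \<times> UNIV)"
  shows "pres_eq X R (rev (map (\<lambda>(x, e). (x, \<not> e)) u) @ u) []"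
  using assms
proof (induction u)
  case Nil
  then show ?case by (simp add: pres_refl)
next
  case (Cons l u)
  obtain x e where l: "l = (x, e)" by fastforce
  have "rev (map (\<lambda>(x, e). (x, \<not> e)) u) \<in> lists (X \<times> UNIV)"
    using Cons.hyps by (auto simp: in_lists_conv_set)
  then have "pres_eq X R (rev (map (\<lambda>(x, e). (x, \<not> e)) u) @ [(x, \<not> e), (x, \<not> \<not> e)] @ u)
      (rev (map (\<lambda>(x, e). (x, \<not> e)) u) @ u)"
    using Cons.hyps l by (intro pres_cancel) auto
  then show ?case
    using pres_trans[OF _ Cons.IH] l by simp
qed

lemma carrier_presented_group:
  "carrier (presented_group X R) = pres_class X R ` lists (X \<times> UNIV)"
  unfolding presented_group_def quotient_def pres_class_def by auto

lemma group_presented_group: "group (presented_group X R)"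
proof (rule groupI)
  let ?G = "presented_group X R" and ?W = "lists (X \<times> (UNIV :: bool set))"
  have one: "\<one>\<^bsub>?G\<^esub> = pres_class X R []"
    by (simp add: presented_group_def)
  show "\<one>\<^bsub>?G\<^esub> \<in> carrier ?G"
    unfolding one carrier_presented_group by blast
  fix x assume "x \<in> carrier ?G"
  then obtain u where u: "u \<in> ?W" "x = pres_class X R u"
    by (auto simp: carrier_presented_group)
  show "\<one>\<^bsub>?G\<^esub> \<otimes>\<^bsub>?G\<^esub> x = x"
    using u presented_group_mult[of "[]" X u R] by (simp add: one)
  let ?u' = "rev (map (\<lambda>(x, e). (x, \<not> e)) u)"
  have u': "?u' \<in> ?W" using u(1) by (auto simp: in_lists_conv_set)
  have "pres_class X R (?u' @ u) = pres_class X R []"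
    using pres_class_eq_iff[of "?u' @ u" X "[]" R] pres_eq_inverse[OF u(1)] u(1) u' by simp
  then have "pres_class X R ?u' \<otimes>\<^bsub>?G\<^esub> x = \<one>\<^bsub>?G\<^esub>"
    using presented_group_mult[OF u' u(1)] by (simp add: one u(2))
  then show "\<exists>y\<in>carrier ?G. y \<otimes>\<^bsub>?G\<^esub> x = \<one>\<^bsub>?G\<^esub>"
    using u' unfolding carrier_presented_group by blast
  fix y assume "y \<in> carrier ?G"
  then obtain v where v: "v \<in> ?W" "y = pres_class X R v"
    by (auto simp: carrier_presented_group)
  show "x \<otimes>\<^bsub>?G\<^esub> y \<in> carrier ?G"
    using u v presented_group_mult[of u X v R] by (auto simp: carrier_presented_group)
  fix z assume "z \<in> carrier ?G"
  then obtain w where w: "w \<in> ?W" "z = pres_class X R w"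
    by (auto simp: carrier_presented_group)
  have "u @ v \<in> ?W" "v @ w \<in> ?W" using u v w by auto
  then show "x \<otimes>\<^bsub>?G\<^esub> y \<otimes>\<^bsub>?G\<^esub> z = x \<otimes>\<^bsub>?G\<^esub> (y \<otimes>\<^bsub>?G\<^esub> z)"
    using u v w by (simp add: presented_group_mult)
qed


section \<open>Surface groups\<close>

datatype surface_gen = Gen_a nat | Gen_b nat

definition surface_gens :: "nat \<Rightarrow> surface_gen set" where
  "surface_gens g = Gen_a ` {1..g} \<union> Gen_b ` {1..g}"

definition surface_relator :: "nat \<Rightarrow> surface_gen letter list" where
  "surface_relator g =
    concat (map (\<lambda>j. [(Gen_a j, True), (Gen_b j, True), (Gen_a j, False), (Gen_b j, False)]) [1..<Suc g])"

definition surface_group :: "nat \<Rightarrow> surface_gen letter list set monoid" where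
  "surface_group g = presented_group (surface_gens g) {surface_relator g}"

definition surface_gen_class :: "nat \<Rightarrow> surface_gen \<Rightarrow> surface_gen letter list set" where
  "surface_gen_class g x = pres_class (surface_gens g) {surface_relator g} [(x, True)]"

definition surface_genset :: "nat \<Rightarrow> surface_gen letter list set set" where
  "surface_genset g =
    (\<Union>x\<in>surface_gens g. {surface_gen_class g x, inv\<^bsub>surface_group g\<^esub> (surface_gen_class g x)})"


section \<open>Cayley graphs, the Markov operator and its norm\<close>

text \<open>A graph is a vertex set together with a set of unordered edges.\<close>

type_synonym 'v graph = "'v set \<times> 'v set set"

definition cayley_graph :: "('a, 'm) monoid_scheme \<Rightarrow> 'a set \<Rightarrow> 'a graph" where
  "cayley_graph G S =
    (carrier G, {{x, y} | x y. x \<in> carrier G \<and> y \<in> carrier G \<and> inv\<^bsub>G\<^esub> x \<otimes>\<^bsub>G\<^esub> y \<in> S})"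

definition neighbours :: "'v graph \<Rightarrow> 'v \<Rightarrow> 'v set" where
  "neighbours X x = {y \<in> fst X. {x, y} \<in> snd X}"

text \<open>The normalising factor is the degree at \<open>x\<close>, which is \<open>k\<close> at every vertex of a
  \<open>k\<close>-regular graph.\<close>

definition markov_operator :: "'v graph \<Rightarrow> ('v \<Rightarrow> complex) \<Rightarrow> 'v \<Rightarrow> complex" where
  "markov_operator X f x =
    (1 / of_nat (card (neighbours X x))) * (\<Sum>y\<in>neighbours X x. f y)"

text \<open>Functions on a vertex set \<open>V\<close> are represented by their extension by zero.\<close>

definition ell2 :: "'v set \<Rightarrow> ('v \<Rightarrow> complex) set" where
  "ell2 V = {f. (\<forall>x. x \<notin> V \<longrightarrow> f x = 0) \<and> (\<lambda>x. (norm (f x))\<^sup>2) summable_on V}"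

definition ell2_norm :: "'v set \<Rightarrow> ('v \<Rightarrow> complex) \<Rightarrow> real" where
  "ell2_norm V f = sqrt (\<Sum>\<^sub>\<infinity>x\<in>V. (norm (f x))\<^sup>2)"

text \<open>The operator norm follows the form of \<^const>\<open>onorm\<close>; the quotient at \<open>f = 0\<close> is \<open>0\<close>.\<close>

definition ell2_onorm :: "'v set \<Rightarrow> (('v \<Rightarrow> complex) \<Rightarrow> 'v \<Rightarrow> complex) \<Rightarrow> real" where
  "ell2_onorm V T = (SUP f\<in>ell2 V. ell2_norm V (T f) / ell2_norm V f)"

definition spectral_radius :: "'v graph \<Rightarrow> real" where
  "spectral_radius X = ell2_onorm (fst X) (markov_operator X)"

definition surface_mu :: "nat \<Rightarrow> real" where
  "surface_mu g = spectral_radius (cayley_graph (surface_group g) (surface_genset g))"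

end

theory Submission
  imports Defs "HOL-Real_Asymp.Real_Asymp"
begin

text \<open>Write \<open>g = m + 1\<close>. The generators \<open>a\<^sub>j, b\<^sub>j\<close> with \<open>j \<le> m\<close> are free in the surface group, and
  the last two contribute only \<open>O(1)\<close> to the norm of the unnormalised adjacency operator, so that
  this norm is \<open>4\<surd>g + O(1)\<close> as for the \<open>4m\<close>-regular tree.

  Freeness is used through a right action of the surface group on \<open>F \<times> \<int>\<close>, where \<open>F\<close> is the set of
  reduced words in the first \<open>2m\<close> generators. These act on \<open>F\<close>; with \<open>c\<close> the product of the first \<open>m\<close>
  commutators, \<open>a\<^sub>g\<close> shifts \<open>\<int>\<close> and \<open>b\<^sub>g\<close> acts on the fibre over \<open>n\<close> by \<open>c\<close> to the power \<open>-n\<close>, so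
  that their commutator acts as the inverse of \<open>c\<close>.

  Upper bound: the Schur test with edge weights read off from the position in \<open>F\<close>. Lower bound: the
  test function decaying like \<open>(4m - 1)\<close> to the power \<open>-n/2\<close> on the reduced words ending in \<open>a\<^sub>1\<close>.\<close>

section \<open>The action on reduced words\<close>

definition flip :: "'x letter \<Rightarrow> 'x letter" where
  "flip l = (fst l, \<not> snd l)"

lemma flip_flip [simp]: "flip (flip l) = l"
  by (simp add: flip_def)

lemma fst_flip [simp]: "fst (flip l) = fst l"
  by (simp add: flip_def)

lemma flip_Pair: "flip (x, e) = (x, \<not> e)"
  by (simp add: flip_def)

text \<open>A free group element is stored with its last letter at the head, so that right
  multiplication by a letter touches only the head of the list.\<close>

fun push :: "'x letter \<Rightarrow> 'x letter list \<Rightarrow> 'x letter list" where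
  "push l [] = [l]"
| "push l (k # w) = (if k = flip l then w else l # k # w)"

abbreviation reduced :: "'x letter list \<Rightarrow> bool" where
  "reduced \<equiv> successively (\<lambda>k l. l \<noteq> flip k)"

lemma reduced_push: "reduced w \<Longrightarrow> reduced (push l w)"
  by (cases w) (auto simp: successively_Cons)

text \<open>If \<open>push l\<close> cancels the head, reducedness says that the next letter is not
  \<open>l\<close>, so \<open>push (flip l)\<close> puts the head back instead of cancelling
  further.\<close>

lemma push_flip_push: "reduced w \<Longrightarrow> push (flip l) (push l w) = w"
  by (cases w; cases "tl w") (auto simp: successively_Cons)

lemma reduced_fold_push: "reduced w \<Longrightarrow> reduced (fold push u w)"
  by (induction u arbitrary: w) (auto simp: reduced_push)

definition inverse_word :: "'x letter list \<Rightarrow> 'x letter list" where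
  "inverse_word u = rev (map flip u)"

lemma inverse_word_inverse_word [simp]: "inverse_word (inverse_word u) = u"
  by (simp add: inverse_word_def rev_map comp_def)

lemma fold_push_inverse_word: "reduced w \<Longrightarrow> fold push (inverse_word u) (fold push u w) = w"
  by (induction u arbitrary: w) (auto simp: inverse_word_def push_flip_push reduced_push)

text \<open>The sign is reversed: \<open>n\<close> acts as the power \<open>-n\<close> of \<open>u\<close>.\<close>

definition push_power :: "'x letter list \<Rightarrow> int \<Rightarrow> 'x letter list \<Rightarrow> 'x letter list" where
  "push_power u n = (if n \<ge> 0 then fold push (inverse_word u) ^^ nat n else fold push u ^^ nat (- n))"

lemma reduced_funpow_push: "reduced w \<Longrightarrow> reduced ((fold push u ^^ n) w)"
  by (induction n) (auto simp: reduced_fold_push)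

lemma reduced_push_power: "reduced w \<Longrightarrow> reduced (push_power u n w)"
  by (simp add: push_power_def reduced_funpow_push)

lemma funpow_push_inverse_word:
  "reduced w \<Longrightarrow> (fold push (inverse_word u) ^^ n) ((fold push u ^^ n) w) = w"
proof (induction n arbitrary: w)
  case (Suc n)
  have "(fold push (inverse_word u) ^^ Suc n) ((fold push u ^^ Suc n) w) =
      fold push (inverse_word u) ((fold push (inverse_word u) ^^ n) ((fold push u ^^ n) (fold push u w)))"
    by (simp only: funpow.simps(2) comp_apply funpow_swap1)
  also have "\<dots> = w"
    using Suc by (simp add: reduced_fold_push fold_push_inverse_word)
  finally show ?case .
qed simp

lemma funpow_push_inverse_word':
  "reduced w \<Longrightarrow> (fold push u ^^ n) ((fold push (inverse_word u) ^^ n) w) = w"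
  using funpow_push_inverse_word[where u = "inverse_word u"] by simp

lemma push_power_minus: "reduced w \<Longrightarrow> push_power u (- n) (push_power u n w) = w"
  by (cases "n = 0") (auto simp: push_power_def funpow_push_inverse_word funpow_push_inverse_word')

text \<open>In the last commutator of the relator, \<open>b\<close> is met in the fibre over
  \<open>n + 1\<close> and its inverse in the fibre over \<open>n\<close>. The powers cancel up to
  one inverse factor.\<close>

lemma push_power_minus_plus_one:
  assumes "reduced w"
  shows "push_power u (- n) (push_power u (n + 1) w) = fold push (inverse_word u) w"
proof (cases "n \<ge> 0")
  case True
  then obtain k where k: "n = int k" using nonneg_int_cases by blast
  have *: "push_power u (n + 1) w = (fold push (inverse_word u) ^^ k) (fold push (inverse_word u) w)"
    unfolding k push_power_def by (simp add: nat_add_distrib funpow_swap1)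
  show ?thesis unfolding * using assms
    by (cases "k = 0") (auto simp: push_power_def k funpow_push_inverse_word' reduced_fold_push)
next
  case False
  \<comment> \<open>For n = -(k + 1) the signs swap: k forward factors are followed by k + 1 inverse
    ones.\<close>
  then obtain k where k: "n = - int (Suc k)"
    by (metis int_cases linorder_not_le of_nat_0_le_iff)
  have *: "push_power u (- n) v = fold push (inverse_word u) ((fold push (inverse_word u) ^^ k) v)" for v
    unfolding k minus_minus nat_int push_power_def by (simp add: nat_add_distrib)
  have "push_power u (n + 1) w = (fold push u ^^ k) w"
    by (cases "k = 0") (auto simp: push_power_def k)
  then show ?thesis unfolding * using assms
    by (simp add: funpow_push_inverse_word)
qed

text \<open>The index of a letter outside \<open>surface_gens m\<close> is ignored: in words over
  \<open>surface_gens (Suc m)\<close> it can only be \<open>Suc m\<close>.\<close>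

definition step :: "nat \<Rightarrow> surface_gen letter \<Rightarrow> surface_gen letter list \<times> int \<Rightarrow>
    surface_gen letter list \<times> int" where
  "step m l s = (if fst l \<in> surface_gens m then (push l (fst s), snd s) else
    case fst l of
      Gen_a _ \<Rightarrow> (fst s, if snd l then snd s + 1 else snd s - 1)
    | Gen_b _ \<Rightarrow> (push_power (surface_relator m) (if snd l then snd s else - snd s) (fst s), snd s))"

lemma reduced_step: "reduced (fst s) \<Longrightarrow> reduced (fst (step m l s))"
  by (auto simp: step_def reduced_push reduced_push_power split: surface_gen.split)

text \<open>A \<open>b\<close> letter stays in its fibre, so its inverse acts there with the negated
  exponent. The two instances of \<open>push_power_minus\<close> cover the two signs of the
  letter.\<close>

lemma step_flip_step: "reduced (fst s) \<Longrightarrow> step m (flip l) (step m l s) = s"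
  using push_power_minus[of "fst s" "surface_relator m" "snd s"]
    push_power_minus[of "fst s" "surface_relator m" "- snd s"]
  by (cases "fst l \<in> surface_gens m")
    (auto simp: step_def push_flip_push, auto simp: flip_def prod_eq_iff split: surface_gen.splits)

lemma reduced_fold_step: "reduced (fst s) \<Longrightarrow> reduced (fst (fold (step m) u s))"
  by (induction u arbitrary: s) (auto simp: reduced_step)

lemma fold_step_low:
  "u \<in> lists (surface_gens m \<times> UNIV) \<Longrightarrow> fold (step m) u s = (fold push u (fst s), snd s)"
  by (induction u arbitrary: s) (auto simp: step_def)

lemma surface_relator_Suc:
  "surface_relator (Suc m) = surface_relator m @
    [(Gen_a (Suc m), True), (Gen_b (Suc m), True), (Gen_a (Suc m), False), (Gen_b (Suc m), False)]"
  by (simp add: surface_relator_def)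

lemma surface_gens_mono: "m \<le> n \<Longrightarrow> surface_gens m \<subseteq> surface_gens n"
  by (auto simp: surface_gens_def)

lemma surface_relator_in_lists: "surface_relator m \<in> lists (surface_gens m \<times> UNIV)"
proof (induction m)
  case 0
  then show ?case by (simp add: surface_relator_def)
next
  case (Suc m)
  have "lists (surface_gens m \<times> (UNIV :: bool set)) \<subseteq> lists (surface_gens (Suc m) \<times> UNIV)"
    using surface_gens_mono[of m "Suc m"] by (intro lists_mono) auto
  with Suc show ?case
    unfolding surface_relator_Suc by (auto simp: surface_gens_def)
qed

text \<open>The first \<open>m\<close> commutators act on the word by \<open>c\<close>. The last one
  acts by the inverse of \<open>c\<close>, and its two \<open>a\<close> letters restore the
  integer.\<close>

lemma fold_step_surface_relator:
  assumes "reduced (fst s)"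
  shows "fold (step m) (surface_relator (Suc m)) s = s"
proof -
  have top: "Gen_a (Suc m) \<notin> surface_gens m" "Gen_b (Suc m) \<notin> surface_gens m"
    by (auto simp: surface_gens_def)
  let ?r = "surface_relator m" and ?w = "fold push (surface_relator m) (fst s)"
  have "push_power ?r (- snd s) (push_power ?r (snd s + 1) ?w) = fst s"
    using assms push_power_minus_plus_one[of ?w ?r "snd s"]
    by (simp add: reduced_fold_push fold_push_inverse_word)
  then show ?thesis
    unfolding surface_relator_Suc
    by (simp add: fold_step_low[OF surface_relator_in_lists] step_def top)
qed

abbreviation surface_eq :: "nat \<Rightarrow> surface_gen letter list \<Rightarrow> surface_gen letter list \<Rightarrow> bool" where
  "surface_eq g \<equiv> pres_eq (surface_gens g) {surface_relator g}"

text \<open>Cancelling pairs and the relator both act trivially on reduced words, so the action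
  factors through the surface group.\<close>

lemma fold_step_surface_eq:
  assumes "surface_eq (Suc m) u v" "reduced (fst s)"
  shows "fold (step m) u s = fold (step m) v s"
  using assms
proof (induction arbitrary: s)
  case (pres_cancel u v x e)
  have "step m (x, \<not> e) (step m (x, e) (fold (step m) u s)) = fold (step m) u s"
    using step_flip_step[of "fold (step m) u s" m "(x, e)"] reduced_fold_step[OF pres_cancel.prems]
    by (simp add: flip_Pair)
  then show ?case by simp
next
  case (pres_relator u v r)
  then show ?case by (simp add: fold_step_surface_relator reduced_fold_step)
qed auto

section \<open>Exponent sums as invariants of group elements\<close>

definition exponent_sum :: "'x \<Rightarrow> 'x letter list \<Rightarrow> int" where
  "exponent_sum x u = (\<Sum>l\<leftarrow>u. if fst l = x then if snd l then 1 else -1 else 0)"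

lemma exponent_sum_surface_relator: "exponent_sum x (surface_relator m) = 0"
  by (induction m) (auto simp: exponent_sum_def surface_relator_Suc, simp add: surface_relator_def)

lemma exponent_sum_surface_eq: "surface_eq g u v \<Longrightarrow> exponent_sum x u = exponent_sum x v"
proof (induction rule: pres_eq.induct)
  case (pres_relator u v r)
  then show ?case using exponent_sum_surface_relator[of x g] by (simp add: exponent_sum_def)
qed (auto simp: exponent_sum_def)

text \<open>The exponent sum of the generator of \<open>l\<close> is 1 or -1 on \<open>[l]\<close>
  according to its sign, and 0 on every letter of another generator.\<close>

lemma surface_eq_single_letter: "surface_eq g [l] [k] \<Longrightarrow> l = k"
  using exponent_sum_surface_eq[of g "[l]" "[k]" "fst l"]
  by (auto simp: exponent_sum_def prod_eq_iff split: if_splits)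

section \<open>The Cayley graph\<close>

abbreviation letters :: "nat \<Rightarrow> surface_gen letter set" where
  "letters g \<equiv> surface_gens g \<times> UNIV"

abbreviation word_class :: "nat \<Rightarrow> surface_gen letter list \<Rightarrow> surface_gen letter list set" where
  "word_class g \<equiv> pres_class (surface_gens g) {surface_relator g}"

abbreviation surface_graph :: "nat \<Rightarrow> surface_gen letter list set graph" where
  "surface_graph g \<equiv> cayley_graph (surface_group g) (surface_genset g)"

abbreviation vertices :: "nat \<Rightarrow> surface_gen letter list set set" where
  "vertices g \<equiv> carrier (surface_group g)"

definition translate :: "nat \<Rightarrow> surface_gen letter \<Rightarrow> surface_gen letter list set \<Rightarrow> surface_gen letter list set" where
  "translate g l x = x \<otimes>\<^bsub>surface_group g\<^esub> word_class g [l]"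

lemma flip_in_letters [simp]: "flip l \<in> letters g \<longleftrightarrow> l \<in> letters g"
  by (auto simp: mem_Times_iff)

lemma finite_letters [simp]: "finite (letters g)"
  by (simp add: surface_gens_def)

lemma card_letters: "card (letters g) = 4 * g"
proof -
  have "card (surface_gens g) = 2 * g"
    unfolding surface_gens_def by (subst card_Un_disjoint) (auto simp: card_image inj_on_def)
  then show ?thesis by (simp add: card_cartesian_product)
qed

lemma letters_mono: "m \<le> n \<Longrightarrow> letters m \<subseteq> letters n"
  using surface_gens_mono[of m n] by auto

lemma vertices_eq: "vertices g = word_class g ` lists (letters g)"
  by (simp add: surface_group_def carrier_presented_group)

lemma translate_word_class:
  "u \<in> lists (letters g) \<Longrightarrow> l \<in> letters g \<Longrightarrow> translate g l (word_class g u) = word_class g (u @ [l])"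
  by (simp add: translate_def surface_group_def presented_group_mult)

lemma translate_in_vertices: "x \<in> vertices g \<Longrightarrow> l \<in> letters g \<Longrightarrow> translate g l x \<in> vertices g"
proof -
  assume "x \<in> vertices g" and l: "l \<in> letters g"
  then obtain u where u: "u \<in> lists (letters g)" "x = word_class g u"
    by (auto simp: vertices_eq)
  then have "u @ [l] \<in> lists (letters g)" using l by simp
  then show "translate g l x \<in> vertices g"
    unfolding u(2) translate_word_class[OF u(1) l] vertices_eq by (rule imageI)
qed

lemma surface_eq_cancel_right:
  assumes "u \<in> lists (letters g)" "l \<in> letters g"
  shows "surface_eq g (u @ [l, flip l]) u"
proof -
  obtain x e where l: "l = (x, e)" by fastforce
  show ?thesis
    using pres_cancel[of u "surface_gens g" "[]" x "{surface_relator g}" e] assms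
    by (auto simp: l flip_Pair)
qed

lemma word_class_cancel_right:
  assumes "u \<in> lists (letters g)" "l \<in> letters g"
  shows "word_class g (u @ [l, flip l]) = word_class g u"
proof -
  have "u @ [l, flip l] \<in> lists (letters g)" using assms flip_in_letters[of l g] by simp
  then show ?thesis using surface_eq_cancel_right[OF assms] assms(1) by (simp add: pres_class_eq_iff)
qed

lemma translate_flip_translate:
  assumes "x \<in> vertices g" "l \<in> letters g"
  shows "translate g (flip l) (translate g l x) = x"
proof -
  obtain u where u: "u \<in> lists (letters g)" "x = word_class g u"
    using assms(1) by (auto simp: vertices_eq)
  have ul: "u @ [l] \<in> lists (letters g)" using u(1) assms(2) by simp
  have "translate g (flip l) (translate g l x) = word_class g ((u @ [l]) @ [flip l])"
    unfolding u(2) translate_word_class[OF u(1) assms(2)]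
    using ul assms(2) by (intro translate_word_class) simp_all
  with word_class_cancel_right[OF u(1) assms(2)] show ?thesis
    by (simp add: u(2))
qed

lemma group_surface_group: "group (surface_group g)"
  unfolding surface_group_def by (rule group_presented_group)

lemma inv_letter_class:
  assumes "l \<in> letters g"
  shows "inv\<^bsub>surface_group g\<^esub> (word_class g [l]) = word_class g [flip l]"
proof -
  interpret group "surface_group g" by (rule group_surface_group)
  have l: "word_class g [l] \<in> vertices g" "word_class g [flip l] \<in> vertices g"
    using assms flip_in_letters[of l g] by (auto simp: vertices_eq)
  have "word_class g [flip l] \<otimes>\<^bsub>surface_group g\<^esub> word_class g [l] = \<one>\<^bsub>surface_group g\<^esub>"
    using translate_word_class[of "[flip l]" g l] word_class_cancel_right[of "[]" g "flip l"]
      assms flip_in_letters[of l g]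
    by (simp add: translate_def surface_group_def presented_group_def)
  then show ?thesis using l by (intro inv_equality)
qed

lemma surface_genset_eq: "surface_genset g = (\<lambda>l. word_class g [l]) ` letters g"
proof -
  have inv: "inv\<^bsub>surface_group g\<^esub> (surface_gen_class g x) = word_class g [(x, False)]"
    if "x \<in> surface_gens g" for x
    using inv_letter_class[of "(x, True)" g] that by (simp add: surface_gen_class_def flip_Pair)
  show ?thesis
  proof
    show "surface_genset g \<subseteq> (\<lambda>l. word_class g [l]) ` letters g"
      using inv by (auto simp: surface_genset_def surface_gen_class_def)
    show "(\<lambda>l. word_class g [l]) ` letters g \<subseteq> surface_genset g"
    proof clarify
      fix x e assume "x \<in> surface_gens g"
      then show "word_class g [(x, e)] \<in> surface_genset g"
        using inv by (cases e) (force simp: surface_genset_def surface_gen_class_def)+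
    qed
  qed
qed

lemma fst_surface_graph [simp]: "fst (surface_graph g) = vertices g"
  by (simp add: cayley_graph_def)

lemma neighbours_surface_graph:
  assumes x: "x \<in> vertices g"
  shows "neighbours (surface_graph g) x = (\<lambda>l. translate g l x) ` letters g"
proof -
  interpret group "surface_group g" by (rule group_surface_group)
  have cl: "word_class g [l] \<in> vertices g" if "l \<in> letters g" for l
    using that by (auto simp: vertices_eq)
  have edge: "inv\<^bsub>surface_group g\<^esub> x \<otimes>\<^bsub>surface_group g\<^esub> y \<in> surface_genset g \<longleftrightarrow>
      (\<exists>l\<in>letters g. y = translate g l x)" if "x \<in> vertices g" "y \<in> vertices g" for x y
  proof -
    have "inv\<^bsub>surface_group g\<^esub> x \<otimes>\<^bsub>surface_group g\<^esub> y = word_class g [l] \<longleftrightarrow> y = translate g l x"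
      if "l \<in> letters g" for l
      using \<open>x \<in> _\<close> \<open>y \<in> _\<close> cl[OF that] unfolding translate_def
      by (metis inv_solve_left)
    then show ?thesis unfolding surface_genset_eq by blast
  qed
  have "y \<in> neighbours (surface_graph g) x \<longleftrightarrow> y \<in> (\<lambda>l. translate g l x) ` letters g" for y
  proof -
    have "y \<in> neighbours (surface_graph g) x \<longleftrightarrow> y \<in> vertices g \<and>
        ((\<exists>l\<in>letters g. y = translate g l x) \<or> (\<exists>l\<in>letters g. x = translate g l y))"
    proof (cases "y \<in> vertices g")
      case True
      have "y \<in> neighbours (surface_graph g) x \<longleftrightarrow>
          inv\<^bsub>surface_group g\<^esub> x \<otimes>\<^bsub>surface_group g\<^esub> y \<in> surface_genset g \<or>
          inv\<^bsub>surface_group g\<^esub> y \<otimes>\<^bsub>surface_group g\<^esub> x \<in> surface_genset g"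
        using x True unfolding neighbours_def cayley_graph_def fst_conv snd_conv mem_Collect_eq
          doubleton_eq_iff by blast
      then show ?thesis
        using x True by (simp only: edge simp_thms)
    qed (simp add: neighbours_def)
    \<comment> \<open>An unordered edge may come from either quotient; both give the same condition
      because the letters are closed under \<open>flip\<close>.\<close>
    also have "\<dots> \<longleftrightarrow> (\<exists>l\<in>letters g. y = translate g l x)"
      using x translate_in_vertices translate_flip_translate flip_in_letters by metis
    finally show ?thesis by auto
  qed
  then show ?thesis by blast
qed

text \<open>Exponent sums separate the classes of single letters and left cancellation does the
  rest. Hence the degree is exactly 4g, and sums over neighbours become sums over letters.\<close>

lemma inj_on_translate:
  assumes "x \<in> vertices g"
  shows "inj_on (\<lambda>l. translate g l x) (letters g)"
proof (rule inj_onI)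
  interpret group "surface_group g" by (rule group_surface_group)
  fix l k assume lk: "l \<in> letters g" "k \<in> letters g" and eq: "translate g l x = translate g k x"
  have "word_class g [l] \<in> vertices g" "word_class g [k] \<in> vertices g"
    using lk by (auto simp: vertices_eq)
  then have "word_class g [l] = word_class g [k]"
    using eq assms by (simp add: translate_def)
  then show "l = k"
    using lk surface_eq_single_letter[of g l k] by (simp add: pres_class_eq_iff)
qed

lemma markov_operator_surface_graph:
  assumes "x \<in> vertices g"
  shows "markov_operator (surface_graph g) f x = (\<Sum>l\<in>letters g. f (translate g l x)) / of_nat (4 * g)"
  unfolding markov_operator_def neighbours_surface_graph[OF assms]
  by (simp add: card_image sum.reindex inj_on_translate[OF assms] card_letters)

lemma inj_on_translate_vertices: "l \<in> letters g \<Longrightarrow> inj_on (translate g l) (vertices g)"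
  by (rule inj_on_inverseI[where g = "translate g (flip l)"]) (rule translate_flip_translate)

section \<open>Transfer from the Cayley graph to the action\<close>

text \<open>The choice is irrelevant, since the action factors through the group.\<close>

definition position :: "nat \<Rightarrow> surface_gen letter list set \<Rightarrow> surface_gen letter list \<times> int" where
  "position m x = fold (step m) (SOME u. u \<in> x) ([], 0)"

lemma position_word_class:
  assumes "u \<in> lists (letters (Suc m))"
  shows "position m (word_class (Suc m) u) = fold (step m) u ([], 0)"
proof -
  have "u \<in> word_class (Suc m) u"
    using assms by (auto simp: pres_class_def pres_rel_def intro: pres_refl)
  then have "(SOME v. v \<in> word_class (Suc m) u) \<in> word_class (Suc m) u"
    by (rule someI)
  then have "surface_eq (Suc m) u (SOME v. v \<in> word_class (Suc m) u)"
    by (simp add: pres_class_def pres_rel_def)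
  from fold_step_surface_eq[OF this, of "([], 0)"] show ?thesis
    by (simp add: position_def)
qed

lemma reduced_position: "reduced (fst (position m x))"
  unfolding position_def by (rule reduced_fold_step) simp

text \<open>Equivariance: crossing an edge of the Cayley graph is one step of the action, so edge
  weights defined on the model pull back to the graph.\<close>

lemma position_translate:
  assumes "x \<in> vertices (Suc m)" "l \<in> letters (Suc m)"
  shows "position m (translate (Suc m) l x) = step m l (position m x)"
proof -
  obtain u where u: "u \<in> lists (letters (Suc m))" "x = word_class (Suc m) u"
    using assms(1) by (auto simp: vertices_eq)
  then have "u @ [l] \<in> lists (letters (Suc m))" using assms(2) by simp
  then show ?thesis
    using position_word_class[of "u @ [l]" m] u assms(2)
    by (simp add: translate_word_class position_word_class)
qed

section \<open>The upper bound\<close>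

text \<open>The Schur test with weights on oriented edges, a form of Gabber's lemma.\<close>

lemma sum_power2_neighbour_sums_le:
  fixes f :: "'v \<Rightarrow> real" and wt :: "'l \<Rightarrow> 'v \<Rightarrow> real"
  assumes "finite A" and bij: "bij_betw \<sigma> A A"
    and act: "\<And>l x. l \<in> A \<Longrightarrow> x \<in> V \<Longrightarrow> act l x \<in> V" "\<And>l. l \<in> A \<Longrightarrow> inj_on (act l) V"
    and pos: "\<And>l x. l \<in> A \<Longrightarrow> x \<in> V \<Longrightarrow> wt l x > 0"
    and wt: "\<And>l x. l \<in> A \<Longrightarrow> x \<in> V \<Longrightarrow> wt l x * wt (\<sigma> l) (act l x) = 1"
    and le: "\<And>x. x \<in> V \<Longrightarrow> (\<Sum>l\<in>A. wt l x) \<le> L"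
    and "L \<ge> 0"
    and f: "(\<lambda>x. (f x)\<^sup>2) summable_on V"
    and F: "finite F" "F \<subseteq> V"
  shows "(\<Sum>x\<in>F. (\<Sum>l\<in>A. f (act l x))\<^sup>2) \<le> L\<^sup>2 * (\<Sum>\<^sub>\<infinity>x\<in>V. (f x)\<^sup>2)"
proof -
  \<comment> \<open>The term \<open>h l y\<close> charges \<open>y\<close> with the weight of the
    reverse edge; \<open>\<sigma>\<close> plays the role of inversion of letters.\<close>
  define h where "h l y = wt (\<sigma> l) y * (f y)\<^sup>2" for l y
  define F' where "F' = (\<Union>l\<in>A. act l ` F)"
  have F': "finite F'" "F' \<subseteq> V"
    using assms(1) F act(1) unfolding F'_def by auto
  have \<sigma>: "\<sigma> l \<in> A" if "l \<in> A" for l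
    using bij that by (auto simp: bij_betw_def)
  have h: "h l y \<ge> 0" if "l \<in> A" "y \<in> V" for l y
    using pos[OF \<sigma>[OF that(1)] that(2)] by (simp add: h_def)
  have *: "(\<Sum>l\<in>A. f (act l x))\<^sup>2 \<le> L * (\<Sum>l\<in>A. h l (act l x))" if x: "x \<in> F" for x
  proof -
    have xV: "x \<in> V" using x F by auto
    \<comment> \<open>Splitting off the root of the weight prepares Cauchy-Schwarz. By reciprocity,
      dividing by \<open>wt l x\<close> is multiplying by the weight of the reverse edge at the
      neighbour.\<close>
    have "(\<Sum>l\<in>A. f (act l x)) = (\<Sum>l\<in>A. sqrt (wt l x) * (f (act l x) / sqrt (wt l x)))"
      using pos[OF _ xV] by (intro sum.cong) (auto simp: less_imp_neq[THEN not_sym])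
    then have "(\<Sum>l\<in>A. f (act l x))\<^sup>2 \<le>
        (\<Sum>l\<in>A. (sqrt (wt l x))\<^sup>2) * (\<Sum>l\<in>A. (f (act l x) / sqrt (wt l x))\<^sup>2)"
      using Cauchy_Schwarz_ineq_sum by metis
    also have "(\<Sum>l\<in>A. (sqrt (wt l x))\<^sup>2) = (\<Sum>l\<in>A. wt l x)"
      using pos[OF _ xV] by (intro sum.cong) (auto simp: less_imp_le)
    also have "(\<Sum>l\<in>A. (f (act l x) / sqrt (wt l x))\<^sup>2) = (\<Sum>l\<in>A. h l (act l x))"
    proof (intro sum.cong refl)
      fix l assume l: "l \<in> A"
      have "wt (\<sigma> l) (act l x) = 1 / wt l x"
        using wt[OF l xV] pos[OF l xV] by (simp add: field_simps)
      then show "(f (act l x) / sqrt (wt l x))\<^sup>2 = h l (act l x)"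
        using pos[OF l xV] by (simp add: h_def power_divide less_imp_le)
    qed
    also have "(\<Sum>l\<in>A. wt l x) * (\<Sum>l\<in>A. h l (act l x)) \<le> L * (\<Sum>l\<in>A. h l (act l x))"
      using le[OF xV] h act(1) xV by (intro mult_right_mono sum_nonneg) auto
    finally show ?thesis .
  qed
  have "(\<Sum>x\<in>F. (\<Sum>l\<in>A. f (act l x))\<^sup>2) \<le> L * (\<Sum>x\<in>F. \<Sum>l\<in>A. h l (act l x))"
    unfolding sum_distrib_left by (intro sum_mono) (use * in \<open>simp add: sum_distrib_left\<close>)
  also have "(\<Sum>x\<in>F. \<Sum>l\<in>A. h l (act l x)) = (\<Sum>l\<in>A. \<Sum>x\<in>F. h l (act l x))"
    by (rule sum.swap)
  \<comment> \<open>Each \<open>act l\<close> is injective, so a vertex \<open>y\<close> is charged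
    at most once per letter.\<close>
  also have "\<dots> \<le> (\<Sum>l\<in>A. \<Sum>y\<in>F'. h l y)"
  proof (rule sum_mono)
    fix l assume l: "l \<in> A"
    have "(\<Sum>x\<in>F. h l (act l x)) = (\<Sum>y\<in>act l ` F. h l y)"
      using inj_on_subset[OF act(2)[OF l] F(2)] by (simp add: sum.reindex)
    also have "\<dots> \<le> (\<Sum>y\<in>F'. h l y)"
      using l F' h by (intro sum_mono2) (auto simp: F'_def)
    finally show "(\<Sum>x\<in>F. h l (act l x)) \<le> (\<Sum>y\<in>F'. h l y)" .
  qed
  also have "\<dots> = (\<Sum>y\<in>F'. (\<Sum>l\<in>A. wt (\<sigma> l) y) * (f y)\<^sup>2)"
    unfolding h_def sum_distrib_right by (rule sum.swap)
  \<comment> \<open>As \<open>\<sigma>\<close> permutes \<open>A\<close>, the row bound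
    \<open>le\<close> applies a second time, now at \<open>y\<close>, and yields the second factor
    \<open>L\<close>.\<close>
  also have "\<dots> = (\<Sum>y\<in>F'. (\<Sum>l\<in>A. wt l y) * (f y)\<^sup>2)"
    by (simp only: sum.reindex_bij_betw[OF bij, of "\<lambda>l. wt l y" for y])
  also have "\<dots> \<le> (\<Sum>y\<in>F'. L * (f y)\<^sup>2)"
    using F' le by (intro sum_mono mult_right_mono) auto
  also have "\<dots> \<le> L * (\<Sum>\<^sub>\<infinity>x\<in>V. (f x)\<^sup>2)"
    unfolding sum_distrib_left[symmetric]
    using F' f \<open>L \<ge> 0\<close> by (intro mult_left_mono finite_sum_le_infsum) auto
  finally show ?thesis
    using \<open>L \<ge> 0\<close> by (simp add: mult_left_mono power2_eq_square mult.assoc)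
qed

text \<open>The letter \<open>l\<close> leads towards the root of the tree of reduced words iff it cancels the head.
  For a \<open>4m\<close>-regular tree the optimal weight would be \<open>\<surd>(4m - 1)\<close>; using \<open>\<surd>(4m)\<close> costs \<open>O(1)\<close>.\<close>

definition edge_weight :: "nat \<Rightarrow> surface_gen letter \<Rightarrow> surface_gen letter list \<times> int \<Rightarrow> real" where
  "edge_weight m l s = (if fst l \<in> surface_gens m
    then if fst s \<noteq> [] \<and> hd (fst s) = flip l then sqrt (4 * real m) else 1 / sqrt (4 * real m)
    else 1)"

lemma edge_weight_pos: "m > 0 \<Longrightarrow> edge_weight m l s > 0"
  by (simp add: edge_weight_def)

text \<open>Reversing a step towards the root gives one away from it and conversely, since after a
  cancellation in a reduced word the new head cannot be \<open>l\<close>. The remaining letters have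
  weight 1 in both directions.\<close>

lemma edge_weight_step:
  assumes "m > 0" "reduced (fst s)"
  shows "edge_weight m l s * edge_weight m (flip l) (step m l s) = 1"
  using assms by (cases "fst s"; cases "tl (fst s)")
    (auto simp: edge_weight_def step_def successively_Cons)

text \<open>At most one letter leads towards the root, with weight sqrt(4m); the others of index at
  most \<open>m\<close> add at most 4m / sqrt(4m), which is sqrt(4m) again. The four letters of
  index \<open>Suc m\<close> add 4.\<close>

lemma sum_edge_weight_le:
  assumes "m > 0"
  shows "(\<Sum>l\<in>letters (Suc m). edge_weight m l s) \<le> 4 * sqrt (real m) + 4"
proof -
  let ?q = "sqrt (4 * real m)"
  have q: "?q = 2 * sqrt (real m)" "?q > 0"
    using assms by (simp_all add: real_sqrt_mult)
  \<comment> \<open>For the empty word \<open>hd\<close> is unspecified, but the majorant stays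
    valid: its extra term is nonnegative.\<close>
  have "(\<Sum>l\<in>letters m. edge_weight m l s) \<le>
      (\<Sum>l\<in>letters m. (if l = flip (hd (fst s)) then ?q else 0) + 1 / ?q)"
  proof (rule sum_mono)
    fix l assume "l \<in> letters m"
    then have l: "fst l \<in> surface_gens m" by (simp add: mem_Times_iff)
    show "edge_weight m l s \<le> (if l = flip (hd (fst s)) then ?q else 0) + 1 / ?q"
    proof (cases "fst s \<noteq> [] \<and> hd (fst s) = flip l")
      case True
      then have "l = flip (hd (fst s))" by simp
      then show ?thesis
        unfolding edge_weight_def if_P[OF l] if_P[OF True] using q by simp
    next
      case False
      show ?thesis
        unfolding edge_weight_def if_P[OF l] if_not_P[OF False] using q by simp
    qed
  qed
  also have "\<dots> \<le> ?q + 4 * real m / ?q"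
    using q by (simp add: sum.distrib card_letters)
  also have "4 * real m / ?q = ?q"
    by (rule real_div_sqrt) simp
  finally have "(\<Sum>l\<in>letters m. edge_weight m l s) \<le> 4 * sqrt (real m)"
    using q by simp
  moreover have "(\<Sum>l\<in>letters (Suc m) - letters m. edge_weight m l s) = 4"
  proof -
    have "(\<Sum>l\<in>letters (Suc m) - letters m. edge_weight m l s) =
        (\<Sum>l\<in>letters (Suc m) - letters m. 1)"
      by (intro sum.cong) (auto simp: edge_weight_def)
    also have "\<dots> = 4"
      using letters_mono[of m "Suc m"] by (simp add: card_Diff_subset card_letters)
    finally show ?thesis .
  qed
  ultimately show ?thesis
    using sum.subset_diff[OF letters_mono[of m "Suc m"], of "\<lambda>l. edge_weight m l s"] by simp
qed

text \<open>The bound is stated for finite sets because the square summability of the image under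
  the Markov operator is itself deduced from it.\<close>

lemma sum_markov_operator_le:
  assumes "m > 0" "f \<in> ell2 (vertices (Suc m))" "finite F" "F \<subseteq> vertices (Suc m)"
  shows "(\<Sum>x\<in>F. (norm (markov_operator (surface_graph (Suc m)) f x))\<^sup>2) \<le>
    ((sqrt (real m) + 1) / real (Suc m))\<^sup>2 * (\<Sum>\<^sub>\<infinity>x\<in>vertices (Suc m). (norm (f x))\<^sup>2)"
proof -
  let ?g = "Suc m"
  have "(\<Sum>x\<in>F. (norm (markov_operator (surface_graph ?g) f x))\<^sup>2) \<le>
      (\<Sum>x\<in>F. (\<Sum>l\<in>letters ?g. norm (f (translate ?g l x)))\<^sup>2 / (4 * real ?g)\<^sup>2)"
  proof (rule sum_mono)
    fix x assume "x \<in> F"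
    then have "markov_operator (surface_graph ?g) f x =
        (\<Sum>l\<in>letters ?g. f (translate ?g l x)) / of_nat (4 * ?g)"
      using assms(4) by (intro markov_operator_surface_graph) auto
    then have "norm (markov_operator (surface_graph ?g) f x) =
        norm (\<Sum>l\<in>letters ?g. f (translate ?g l x)) / (4 * real ?g)"
      by (simp only: norm_divide norm_of_nat)
    also have "\<dots> \<le> (\<Sum>l\<in>letters ?g. norm (f (translate ?g l x))) / (4 * real ?g)"
      by (intro divide_right_mono norm_sum) simp
    finally have "norm (markov_operator (surface_graph ?g) f x) \<le>
        (\<Sum>l\<in>letters ?g. norm (f (translate ?g l x))) / (4 * real ?g)" .
    then have "(norm (markov_operator (surface_graph ?g) f x))\<^sup>2 \<le>
        ((\<Sum>l\<in>letters ?g. norm (f (translate ?g l x))) / (4 * real ?g))\<^sup>2"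
      by (intro power_mono) auto
    then show "(norm (markov_operator (surface_graph ?g) f x))\<^sup>2 \<le>
        (\<Sum>l\<in>letters ?g. norm (f (translate ?g l x)))\<^sup>2 / (4 * real ?g)\<^sup>2"
      by (simp only: power_divide)
  qed
  also have "\<dots> = (\<Sum>x\<in>F. (\<Sum>l\<in>letters ?g. norm (f (translate ?g l x)))\<^sup>2) / (4 * real ?g)\<^sup>2"
    by (simp only: sum_divide_distrib)
  also have "(\<Sum>x\<in>F. (\<Sum>l\<in>letters ?g. norm (f (translate ?g l x)))\<^sup>2) \<le>
      (4 * sqrt (real m) + 4)\<^sup>2 * (\<Sum>\<^sub>\<infinity>x\<in>vertices ?g. (norm (f x))\<^sup>2)"
  proof (rule sum_power2_neighbour_sums_le[where \<sigma> = flip and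
        wt = "\<lambda>l x. edge_weight m l (position m x)"])
    show "bij_betw flip (letters ?g) (letters ?g)"
      by (rule bij_betwI[where g = flip]) (auto simp: flip_def)
    show "edge_weight m l (position m x) * edge_weight m (flip l) (position m (translate ?g l x)) = 1"
      if "l \<in> letters ?g" "x \<in> vertices ?g" for l x
      using that assms(1) by (simp only: position_translate edge_weight_step reduced_position)
    show "(\<lambda>x. (norm (f x))\<^sup>2) summable_on vertices ?g"
      using assms(2) by (simp add: ell2_def)
  qed (use assms in \<open>auto intro: translate_in_vertices inj_on_translate_vertices
    edge_weight_pos sum_edge_weight_le simp del: mem_Sigma_iff\<close>)
  finally have "(\<Sum>x\<in>F. (norm (markov_operator (surface_graph ?g) f x))\<^sup>2) \<le>
      (4 * sqrt (real m) + 4)\<^sup>2 * (\<Sum>\<^sub>\<infinity>x\<in>vertices ?g. (norm (f x))\<^sup>2) / (4 * real ?g)\<^sup>2"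
    by (simp add: divide_right_mono)
  also have "(4 * sqrt (real m) + 4)\<^sup>2 * (\<Sum>\<^sub>\<infinity>x\<in>vertices ?g. (norm (f x))\<^sup>2) / (4 * real ?g)\<^sup>2 =
      ((4 * (sqrt (real m) + 1)) / (4 * real ?g))\<^sup>2 * (\<Sum>\<^sub>\<infinity>x\<in>vertices ?g. (norm (f x))\<^sup>2)"
    by (simp add: power_divide algebra_simps del: of_nat_Suc)
  finally show ?thesis
    by (simp only: mult_divide_mult_cancel_left_if) simp
qed

lemma summable_markov_operator:
  assumes "m > 0" "f \<in> ell2 (vertices (Suc m))"
  shows "(\<lambda>x. (norm (markov_operator (surface_graph (Suc m)) f x))\<^sup>2) summable_on vertices (Suc m)"
  using sum_markov_operator_le[OF assms]
  by (intro nonneg_bdd_above_summable_on) (auto simp: bdd_above_def simp del: of_nat_Suc)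

lemma ell2_norm_markov_operator_le:
  assumes "m > 0" "f \<in> ell2 (vertices (Suc m))"
  shows "ell2_norm (vertices (Suc m)) (markov_operator (surface_graph (Suc m)) f) \<le>
    (sqrt (real m) + 1) / real (Suc m) * ell2_norm (vertices (Suc m)) f"
proof -
  have "(\<Sum>\<^sub>\<infinity>x\<in>vertices (Suc m). (norm (markov_operator (surface_graph (Suc m)) f x))\<^sup>2) \<le>
    ((sqrt (real m) + 1) / real (Suc m))\<^sup>2 * (\<Sum>\<^sub>\<infinity>x\<in>vertices (Suc m). (norm (f x))\<^sup>2)"
    by (intro infsum_le_finite_sums summable_markov_operator sum_markov_operator_le assms)
  then show ?thesis
    unfolding ell2_norm_def
    by (intro real_le_lsqrt) (auto simp: power_mult_distrib power_divide infsum_nonneg simp del: of_nat_Suc)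
qed

lemma ell2_norm_ratio_le:
  assumes "m > 0" "f \<in> ell2 (vertices (Suc m))"
  shows "ell2_norm (vertices (Suc m)) (markov_operator (surface_graph (Suc m)) f) /
    ell2_norm (vertices (Suc m)) f \<le> (sqrt (real m) + 1) / real (Suc m)"
proof (cases "ell2_norm (vertices (Suc m)) f = 0")
  case False
  then have "ell2_norm (vertices (Suc m)) f > 0"
    by (simp add: ell2_norm_def infsum_nonneg less_le)
  then show ?thesis
    using ell2_norm_markov_operator_le[OF assms] by (simp only: pos_divide_le_eq)
qed simp

lemma surface_mu_le:
  assumes "m > 0"
  shows "surface_mu (Suc m) \<le> (sqrt (real m) + 1) / real (Suc m)"
proof -
  have "(\<lambda>x. 0) \<in> ell2 (vertices (Suc m))"
    by (simp add: ell2_def)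
  then show ?thesis
    unfolding surface_mu_def spectral_radius_def ell2_onorm_def fst_surface_graph
    by (intro cSUP_least ell2_norm_ratio_le assms) auto
qed

text \<open>The upper bound supplies the boundedness of the quotients that makes the supremum
  meaningful.\<close>

lemma ell2_norm_ratio_le_surface_mu:
  assumes "m > 0" "f \<in> ell2 (vertices (Suc m))"
  shows "ell2_norm (vertices (Suc m)) (markov_operator (surface_graph (Suc m)) f) /
    ell2_norm (vertices (Suc m)) f \<le> surface_mu (Suc m)"
  unfolding surface_mu_def spectral_radius_def ell2_onorm_def fst_surface_graph
  by (rule cSUP_upper[OF assms(2)]) (use ell2_norm_ratio_le[OF assms(1)] in \<open>auto simp: bdd_above_def simp del: of_nat_Suc\<close>)

section \<open>The lower bound\<close>

text \<open>Words grow at the head. Fixing the last letter makes every vertex have exactly \<open>4m - 1\<close>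
  children, the root included.\<close>

primrec tree_level :: "nat \<Rightarrow> nat \<Rightarrow> surface_gen letter list set" where
  "tree_level m 0 = {[(Gen_a 1, True)]}"
| "tree_level m (Suc n) = {l # w | l w. w \<in> tree_level m n \<and> l \<in> letters m \<and> l \<noteq> flip (hd w)}"

lemma tree_levelD:
  assumes "m > 0" "w \<in> tree_level m n"
  shows "length w = Suc n" "reduced w" "w \<in> lists (letters m)"
  using assms(2)
proof (induction n arbitrary: w)
  case 0
  case 1 then show ?case by simp
  case 2 then show ?case using 0 by simp
  case 3 then show ?case using 0 assms(1) by (simp add: surface_gens_def)
next
  case (Suc n)
  {
    case 1 then show ?case using Suc by auto
  next
    case 2 then show ?case using Suc by (auto simp: successively_Cons)
  next
    case 3
    then obtain l v where "w = l # v" "v \<in> tree_level m n" "l \<in> letters m" by auto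
    then show ?case using Suc(3)[of v] by simp
  }
qed

text \<open>Since \<open>flip (hd w)\<close> is itself one of the 4m letters, each word has exactly
  4m - 1 extensions.\<close>

lemma finite_card_tree_level:
  assumes "m > 0"
  shows "finite (tree_level m n) \<and> card (tree_level m n) = (4 * m - 1) ^ n"
proof (induction n)
  case (Suc n)
  let ?S = "SIGMA w:tree_level m n. letters m - {flip (hd w)}"
  have eq: "tree_level m (Suc n) = (\<lambda>(w, l). l # w) ` ?S"
    by force
  have inj: "inj_on (\<lambda>(w, l). l # w) ?S"
    by (auto simp: inj_on_def)
  have c: "card (letters m - {flip (hd w)}) = 4 * m - 1" if "w \<in> tree_level m n" for w
  proof -
    have "w \<noteq> []" "w \<in> lists (letters m)" using tree_levelD[OF assms that] by auto
    then have "flip (hd w) \<in> letters m" unfolding flip_in_letters by (cases w) auto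
    then show ?thesis by (simp add: card_letters)
  qed
  have "card ?S = (\<Sum>w\<in>tree_level m n. card (letters m - {flip (hd w)}))"
    using Suc by (intro card_SigmaI) auto
  also have "\<dots> = (4 * m - 1) ^ Suc n"
    using Suc c by simp
  finally have "card ?S = (4 * m - 1) ^ Suc n" .
  moreover have "finite ?S" using Suc by (intro finite_SigmaI) auto
  ultimately show ?case unfolding eq using inj by (simp add: card_image)
qed simp

section \<open>Embedding the tree in the Cayley graph\<close>

lemma fold_push_rev: "reduced w \<Longrightarrow> fold push (rev w) [] = w"
proof (induction w)
  case (Cons l w)
  then show ?case by (cases w) auto
qed simp

text \<open>The reversal matches the storage order of \<open>push\<close>: the head of
  \<open>w\<close> is the last letter of the group word, so children are right translates.\<close>

definition tree_vertex :: "nat \<Rightarrow> surface_gen letter list \<Rightarrow> surface_gen letter list set" where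
  "tree_vertex m w = word_class (Suc m) (rev w)"

lemma lists_letters_Suc: "w \<in> lists (letters m) \<Longrightarrow> w \<in> lists (letters (Suc m))"
  using lists_mono[OF letters_mono[of m "Suc m"]] by auto

lemma tree_vertex_in_vertices: "w \<in> lists (letters m) \<Longrightarrow> tree_vertex m w \<in> vertices (Suc m)"
  using lists_letters_Suc[of w m] unfolding tree_vertex_def vertices_eq by (intro imageI) auto

text \<open>The action recovers \<open>w\<close> from its vertex, so distinct tree words are
  distinct group elements. Here freeness enters the lower bound.\<close>

lemma position_tree_vertex:
  assumes "reduced w" "w \<in> lists (letters m)"
  shows "position m (tree_vertex m w) = (w, 0)"
proof -
  have w: "rev w \<in> lists (letters m)" using assms(2) by auto
  have "position m (tree_vertex m w) = fold (step m) (rev w) ([], 0)"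
    unfolding tree_vertex_def by (intro position_word_class lists_letters_Suc w)
  then show ?thesis using assms(1) by (simp only: fold_step_low[OF w] fst_conv snd_conv fold_push_rev)
qed

lemma translate_tree_vertex:
  assumes "w \<in> lists (letters m)" "l \<in> letters m"
  shows "translate (Suc m) l (tree_vertex m w) = tree_vertex m (l # w)"
proof -
  have w: "rev w \<in> lists (letters (Suc m))" using lists_letters_Suc[OF assms(1)] by auto
  have l: "l \<in> letters (Suc m)" using assms(2) letters_mono[of m "Suc m"] by auto
  show ?thesis unfolding tree_vertex_def translate_word_class[OF w l] by simp
qed

section \<open>Truncated radial test functions\<close>

definition tree_ball :: "nat \<Rightarrow> nat \<Rightarrow> surface_gen letter list set" where
  "tree_ball m N = (\<Union>n\<le>N. tree_level m n)"

text \<open>Words of level \<open>n\<close> have length \<open>n + 1\<close>, hence the exponent.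
  The decay rate gives every level up to \<open>N\<close> squared mass 1, and the cut-off makes the
  support finite.\<close>

definition test_function :: "nat \<Rightarrow> nat \<Rightarrow> surface_gen letter list set \<Rightarrow> real" where
  "test_function m N x = (if x \<in> tree_vertex m ` tree_ball m N
    then (1 / sqrt (real (4 * m - 1))) ^ (length (fst (position m x)) - 1) else 0)"

lemma test_function_nonneg: "test_function m N x \<ge> 0"
  by (simp add: test_function_def)

lemma test_function_tree_vertex:
  assumes "m > 0" "w \<in> tree_level m n" "n \<le> N"
  shows "test_function m N (tree_vertex m w) = (1 / sqrt (real (4 * m - 1))) ^ n"
proof -
  have "w \<in> tree_ball m N" using assms by (auto simp: tree_ball_def)
  then show ?thesis
    using tree_levelD[OF assms(1,2)] by (simp add: test_function_def position_tree_vertex)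
qed

lemma inj_on_tree_vertex:
  assumes "m > 0"
  shows "inj_on (tree_vertex m) (tree_ball m N)"
proof (rule inj_on_inverseI)
  fix w assume "w \<in> tree_ball m N"
  then obtain n where "w \<in> tree_level m n" by (auto simp: tree_ball_def)
  from tree_levelD[OF assms this] show "fst (position m (tree_vertex m w)) = w"
    by (simp add: position_tree_vertex)
qed

lemma disjoint_tree_levels:
  assumes "m > 0" "n \<noteq> k"
  shows "tree_level m n \<inter> tree_level m k = {}"
proof (rule equals0I)
  fix w assume "w \<in> tree_level m n \<inter> tree_level m k"
  then have "length w = Suc n" "length w = Suc k"
    using tree_levelD(1)[OF assms(1)] by blast+
  with assms(2) show False by simp
qed

lemma tree_ball_vertices: "m > 0 \<Longrightarrow> tree_vertex m ` tree_ball m N \<subseteq> vertices (Suc m)"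
  using tree_levelD(3) tree_vertex_in_vertices unfolding tree_ball_def by blast

lemma power2_power_inverse_sqrt:
  assumes "m > 0"
  shows "real ((4 * m - 1) ^ n) * ((1 / sqrt (real (4 * m - 1))) ^ n)\<^sup>2 = 1"
proof -
  let ?q = "real (4 * m - 1)"
  have q: "?q > 0" using assms by simp
  have "((1 / sqrt ?q) ^ n)\<^sup>2 = ((1 / sqrt ?q)\<^sup>2) ^ n"
    by (simp only: power_mult[symmetric] mult.commute)
  also have "(1 / sqrt ?q)\<^sup>2 = 1 / ?q"
    using q by (simp add: power_divide del: of_nat_diff)
  finally show ?thesis
    using q by (simp only: of_nat_power power_mult_distrib[symmetric]) simp
qed

lemma test_function_norm:
  assumes "m > 0"
  shows "((\<lambda>x. (test_function m N x)\<^sup>2) has_sum (real N + 1)) (vertices (Suc m))"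
proof -
  let ?T = "tree_vertex m ` tree_ball m N"
  have fin: "finite (tree_ball m N)"
    using finite_card_tree_level[OF assms] by (auto simp: tree_ball_def)
  have "(\<Sum>x\<in>?T. (test_function m N x)\<^sup>2) =
      (\<Sum>w\<in>tree_ball m N. (test_function m N (tree_vertex m w))\<^sup>2)"
    by (simp add: sum.reindex inj_on_tree_vertex assms)
  also have "\<dots> = (\<Sum>n\<le>N. \<Sum>w\<in>tree_level m n. (test_function m N (tree_vertex m w))\<^sup>2)"
    unfolding tree_ball_def
    using finite_card_tree_level[OF assms] disjoint_tree_levels[OF assms]
    by (intro sum.UNION_disjoint) auto
  also have "\<dots> = (\<Sum>n\<le>N. 1)"
  proof (rule sum.cong[OF refl])
    fix n assume "n \<in> {..N}"
    then have "(\<Sum>w\<in>tree_level m n. (test_function m N (tree_vertex m w))\<^sup>2) =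
        (\<Sum>w\<in>tree_level m n. ((1 / sqrt (real (4 * m - 1))) ^ n)\<^sup>2)"
      by (intro sum.cong) (simp_all add: test_function_tree_vertex[OF assms])
    also have "\<dots> = 1"
      using finite_card_tree_level[OF assms, of n] power2_power_inverse_sqrt[OF assms, of n]
      by (simp del: of_nat_power)
    finally show "(\<Sum>w\<in>tree_level m n. (test_function m N (tree_vertex m w))\<^sup>2) = 1" .
  qed
  finally have "((\<lambda>x. (test_function m N x)\<^sup>2) has_sum (real N + 1)) ?T"
    using fin by (simp add: has_sum_finiteI)
  then show ?thesis
    by (rule has_sum_cong_neutral[THEN iffD1, rotated -1])
      (use tree_ball_vertices[OF assms] in \<open>auto simp: test_function_def\<close>)
qed

text \<open>With q = 4m - 1 and r = 1 / sqrt q, the parent contributes r^n and the q children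
  together q r^(n + 2), which is r^n again. The letters of index \<open>Suc m\<close> add only
  nonnegative terms.\<close>

lemma sum_neighbours_test_function_ge:
  assumes "m > 0" "w \<in> tree_level m (Suc n)" "Suc (Suc n) \<le> N"
  shows "(\<Sum>l\<in>letters (Suc m). test_function m N (translate (Suc m) l (tree_vertex m w))) \<ge>
    2 * sqrt (real (4 * m - 1)) * (1 / sqrt (real (4 * m - 1))) ^ Suc n"
proof -
  let ?q = "real (4 * m - 1)" and ?h = "\<lambda>l. test_function m N (translate (Suc m) l (tree_vertex m w))"
  let ?r = "1 / sqrt ?q"
  obtain k v where w: "w = k # v" "v \<in> tree_level m n" "k \<in> letters m"
    using assms(2) by auto
  have q: "?q > 0" using assms(1) by simp
  have wl: "w \<in> lists (letters m)" and vl: "v \<in> lists (letters m)"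
    using tree_levelD(3)[OF assms(1)] assms(2) w(2) by blast+
  have "translate (Suc m) (flip k) (tree_vertex m w) = tree_vertex m v"
    using w(3) letters_mono[of m "Suc m"] tree_vertex_in_vertices[OF vl]
    unfolding w(1) translate_tree_vertex[OF vl w(3), symmetric]
    by (intro translate_flip_translate) auto
  then have parent: "?h (flip k) = ?r ^ n"
    using assms w(2) by (simp add: test_function_tree_vertex)
  have child: "?h l = ?r ^ Suc (Suc n)" if "l \<in> letters m - {flip k}" for l
  proof -
    have l: "l \<in> letters m" "l \<noteq> flip k" using that by auto
    have "l # w \<in> tree_level m (Suc (Suc n))"
      unfolding tree_level.simps(2)[of m "Suc n"] using assms(2) l w(1) by auto
    then show ?thesis
      unfolding translate_tree_vertex[OF wl l(1)] using assms by (intro test_function_tree_vertex)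
  qed
  have fk: "flip k \<in> letters m" using w(3) by (simp only: flip_in_letters)
  have "2 * sqrt ?q * ?r ^ Suc n = ?r ^ n + ?q * ?r ^ Suc (Suc n)"
  proof -
    have 1: "sqrt ?q * ?r = 1" and 2: "?q * ?r = sqrt ?q"
      using q by (simp_all add: real_div_sqrt)
    have "2 * sqrt ?q * ?r ^ Suc n = 2 * (sqrt ?q * ?r) * ?r ^ n" by simp
    moreover have "?q * ?r ^ Suc (Suc n) = (?q * ?r) * ?r * ?r ^ n" by simp
    ultimately show ?thesis unfolding 2 1 by simp
  qed
  also have "?q * ?r ^ Suc (Suc n) = (\<Sum>l\<in>letters m - {flip k}. ?h l)"
    using child fk by (simp add: card_letters del: power_Suc mem_Sigma_iff)
  also have "?r ^ n + (\<Sum>l\<in>letters m - {flip k}. ?h l) = (\<Sum>l\<in>letters m. ?h l)"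
    unfolding parent[symmetric] by (rule sum.remove[symmetric]) (use fk in auto)
  also have "\<dots> \<le> (\<Sum>l\<in>letters (Suc m). ?h l)"
    using letters_mono[of m "Suc m"] by (intro sum_mono2) (auto simp: test_function_nonneg)
  finally show ?thesis .
qed

text \<open>In the ball of radius \<open>N + 2\<close> the vertices of levels 1 to
  \<open>N + 1\<close> have their parent and all children inside. Each of these \<open>N + 1\<close>
  levels contributes the same amount.\<close>

lemma sum_markov_test_function_ge:
  assumes "m > 0"
  shows "(\<Sum>\<^sub>\<infinity>x\<in>vertices (Suc m). (norm (markov_operator (surface_graph (Suc m))
      (\<lambda>x. complex_of_real (test_function m (Suc (Suc N)) x)) x))\<^sup>2) \<ge>
    (real N + 1) * (2 * sqrt (real (4 * m - 1)) / (4 * real (Suc m)))\<^sup>2"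
proof -
  let ?f = "test_function m (Suc (Suc N))" and ?q = "real (4 * m - 1)"
  let ?M = "\<lambda>x. (norm (markov_operator (surface_graph (Suc m)) (\<lambda>x. complex_of_real (?f x)) x))\<^sup>2"
  let ?B = "\<Union>n\<le>N. tree_level m (Suc n)"
  have B: "?B \<subseteq> tree_ball m (Suc (Suc N))"
    by (force simp: tree_ball_def simp del: tree_level.simps)
  have fin: "finite ?B"
    using finite_card_tree_level[OF assms] by (auto simp del: tree_level.simps)
  have ell2: "(\<lambda>x. complex_of_real (?f x)) \<in> ell2 (vertices (Suc m))"
    using test_function_norm[OF assms, THEN has_sum_imp_summable] tree_ball_vertices[OF assms]
    by (auto simp: ell2_def test_function_def)
  have "(real N + 1) * (2 * sqrt ?q / (4 * real (Suc m)))\<^sup>2 =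
      (\<Sum>n\<le>N. \<Sum>w\<in>tree_level m (Suc n). (2 * sqrt ?q * (1 / sqrt ?q) ^ Suc n / (4 * real (Suc m)))\<^sup>2)"
  proof -
    have "(\<Sum>w\<in>tree_level m (Suc n). (2 * sqrt ?q * (1 / sqrt ?q) ^ Suc n / (4 * real (Suc m)))\<^sup>2) =
        (2 * sqrt ?q / (4 * real (Suc m)))\<^sup>2" for n
    proof -
      have "(\<Sum>w\<in>tree_level m (Suc n). (2 * sqrt ?q * (1 / sqrt ?q) ^ Suc n / (4 * real (Suc m)))\<^sup>2) =
          real ((4 * m - 1) ^ Suc n) * ((1 / sqrt ?q) ^ Suc n)\<^sup>2 * (2 * sqrt ?q / (4 * real (Suc m)))\<^sup>2"
        using finite_card_tree_level[OF assms, of "Suc n"]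
        by (simp add: power_mult_distrib power_divide del: of_nat_Suc power_Suc of_nat_power tree_level.simps)
      then show ?thesis
        unfolding power2_power_inverse_sqrt[OF assms, of "Suc n"] by (simp only: mult_1)
    qed
    then show ?thesis by (simp only: sum_constant card_atMost) simp
  qed
  also have "\<dots> \<le> (\<Sum>n\<le>N. \<Sum>w\<in>tree_level m (Suc n). ?M (tree_vertex m w))"
  proof (intro sum_mono)
    fix n w assume n: "n \<in> {..N}" and w: "w \<in> tree_level m (Suc n)"
    let ?s = "\<Sum>l\<in>letters (Suc m). ?f (translate (Suc m) l (tree_vertex m w))"
    have "tree_vertex m w \<in> vertices (Suc m)"
      using tree_levelD(3)[OF assms w] by (rule tree_vertex_in_vertices)
    then have "?M (tree_vertex m w) = (norm (complex_of_real (?s / (4 * real (Suc m)))))\<^sup>2"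
      by (simp add: markov_operator_surface_graph)
    also have "\<dots> = (?s / (4 * real (Suc m)))\<^sup>2"
      by (simp only: norm_of_real power2_abs)
    also have "\<dots> \<ge> (2 * sqrt ?q * (1 / sqrt ?q) ^ Suc n / (4 * real (Suc m)))\<^sup>2"
      using sum_neighbours_test_function_ge[OF assms w, of "Suc (Suc N)"] n
      by (intro power_mono divide_right_mono) auto
    finally show "(2 * sqrt ?q * (1 / sqrt ?q) ^ Suc n / (4 * real (Suc m)))\<^sup>2 \<le> ?M (tree_vertex m w)" .
  qed
  also have "\<dots> = (\<Sum>w\<in>?B. ?M (tree_vertex m w))"
    using finite_card_tree_level[OF assms] disjoint_tree_levels[OF assms]
    by (intro sum.UNION_disjoint[symmetric]) (auto simp del: tree_level.simps)
  also have "\<dots> = (\<Sum>x\<in>tree_vertex m ` ?B. ?M x)"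
    using inj_on_subset[OF inj_on_tree_vertex[OF assms] B] by (simp add: sum.reindex del: tree_level.simps)
  also have "\<dots> \<le> (\<Sum>\<^sub>\<infinity>x\<in>vertices (Suc m). ?M x)"
    using fin by (intro finite_sum_le_infsum summable_markov_operator[OF assms ell2]
      order.trans[OF image_mono[OF B] tree_ball_vertices[OF assms]]) simp_all
  finally show ?thesis .
qed

text \<open>The test function has squared norm \<open>N + 3\<close>, of which the boundary levels
  lose only 2, so the loss factor tends to 1 as \<open>N\<close> grows.\<close>

lemma surface_mu_ge:
  assumes "m > 0"
  shows "2 * sqrt (real (4 * m - 1)) / (4 * real (Suc m)) \<le> surface_mu (Suc m)"
proof -
  let ?c = "2 * sqrt (real (4 * m - 1)) / (4 * real (Suc m))"
  have "sqrt ((real N + 1) / (real N + 3)) * ?c \<le> surface_mu (Suc m)" for N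
  proof -
    let ?f = "\<lambda>x. complex_of_real (test_function m (Suc (Suc N)) x)"
    have sum: "((\<lambda>x. (norm (?f x))\<^sup>2) has_sum (real N + 3)) (vertices (Suc m))"
      using test_function_norm[OF assms, of "Suc (Suc N)"] by (simp add: add_ac)
    have ell2: "?f \<in> ell2 (vertices (Suc m))"
      using has_sum_imp_summable[OF sum] tree_ball_vertices[OF assms]
      by (auto simp: ell2_def test_function_def)
    have norm: "ell2_norm (vertices (Suc m)) ?f = sqrt (real N + 3)"
      using infsumI[OF sum] by (simp add: ell2_norm_def)
    have "sqrt (real N + 1) * ?c = sqrt ((real N + 1) * ?c\<^sup>2)"
      by (simp add: real_sqrt_mult del: of_nat_Suc)
    also have "\<dots> \<le> ell2_norm (vertices (Suc m)) (markov_operator (surface_graph (Suc m)) ?f)"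
      unfolding ell2_norm_def by (intro real_sqrt_le_mono sum_markov_test_function_ge assms)
    finally have "sqrt (real N + 1) * ?c / sqrt (real N + 3) \<le>
        ell2_norm (vertices (Suc m)) (markov_operator (surface_graph (Suc m)) ?f) /
        ell2_norm (vertices (Suc m)) ?f"
      unfolding norm by (intro divide_right_mono) auto
    also have "\<dots> \<le> surface_mu (Suc m)"
      by (rule ell2_norm_ratio_le_surface_mu[OF assms ell2])
    finally show ?thesis by (simp only: real_sqrt_divide times_divide_eq_left)
  qed
  moreover have "(\<lambda>N. sqrt ((real N + 1) / (real N + 3)) * ?c) \<longlonglongrightarrow> 1 * ?c"
    by (intro tendsto_mult_right) real_asymp
  ultimately have "1 * ?c \<le> surface_mu (Suc m)"
    by (intro LIMSEQ_le_const2) auto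
  then show ?thesis by (simp only: mult_1)
qed

text \<open>Both estimates are relaxed to (sqrt g + 1) / g and (sqrt g - 1) / g, whose common
  distance from the main term is 1 / g.\<close>

lemma surface_mu_bound:
  assumes "g \<ge> 2"
  shows "\<bar>surface_mu g - real g powr (- 1 / 2)\<bar> \<le> real g powr (- 1)"
proof -
  obtain m where m: "g = Suc m" "m > 0" using assms by (cases g) auto
  let ?s = "sqrt (real g)"
  have g: "real g > 0" using assms by simp
  have powr: "real g powr (- 1 / 2) = ?s / real g" "real g powr (- 1) = 1 / real g"
    using g real_div_sqrt[of "real g"] real_sqrt_pow2[of "real g"]
    by (auto simp: powr_minus_divide powr_half_sqrt power2_eq_square field_simps)
  have "surface_mu g \<le> (?s + 1) / real g"
  proof -
    have "surface_mu g \<le> (sqrt (real m) + 1) / real g"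
      using surface_mu_le[OF m(2)] m(1) by simp
    also have "\<dots> \<le> (?s + 1) / real g"
      using g m(1) by (intro divide_right_mono add_right_mono real_sqrt_le_mono) auto
    finally show ?thesis .
  qed
  moreover have "(?s - 1) / real g \<le> surface_mu g"
  proof -
    have "2 * ?s = sqrt (4 * real g)" by (simp add: real_sqrt_mult)
    also have "\<dots> \<le> sqrt (real (4 * m - 1)) + 2"
    proof (rule real_le_lsqrt)
      define t where "t = sqrt (real (4 * m - 1))"
      \<comment> \<open>The square of t + 2 is 4m + 3 + 4t, which is at least 4m + 4 = 4g because t
        is at least 1.\<close>
      have "t\<^sup>2 = 4 * real m - 1" "t \<ge> 1"
        using m(2) by (simp_all add: t_def of_nat_diff)
      then show "4 * real g \<le> (sqrt (real (4 * m - 1)) + 2)\<^sup>2"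
        unfolding t_def[symmetric] by (simp add: power2_sum m(1))
    qed auto
    finally have "?s - 1 \<le> sqrt (real (4 * m - 1)) / 2" by simp
    then have "(?s - 1) / real g \<le> sqrt (real (4 * m - 1)) / 2 / real g"
      by (rule divide_right_mono) simp
    also have "\<dots> = 2 * sqrt (real (4 * m - 1)) / (4 * real (Suc m))"
      by (simp add: m(1) del: of_nat_Suc)
    also have "\<dots> \<le> surface_mu g"
      using surface_mu_ge[OF m(2)] m(1) by simp
    finally show ?thesis .
  qed
  ultimately show ?thesis
    unfolding powr by (simp add: abs_le_iff add_divide_distrib diff_divide_distrib)
qed

theorem mainTheorem4:
  "(\<lambda>g::nat. surface_mu g - real g powr (- 1 / 2)) \<in> O(\<lambda>g. real g powr (- 1))"
proof (rule bigoI[where c = 1])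
  show "eventually (\<lambda>g::nat. norm (surface_mu g - real g powr (- 1 / 2)) \<le>
      1 * norm (real g powr (- 1))) at_top"
    using eventually_ge_at_top[of 2] by eventually_elim (use surface_mu_bound in simp)
qed

end
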